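(* Let $p\le n$ be positive integers, let $G\in\mathbb{H}^{n\times n}$ be Hermitian positive definite, and let $X\in\mathrm{St}_G(p,\mathbb{H}^n)=\{X\in\mathbb{H}^{n\times p}\mid X^HGX=I_p\}$. The tangent space of $\mathrm{St}_G(p,\mathbb{H}^n)$ at $X$ is $$T_X\mathrm{St}_G(p,\mathbb{H}^n)=\{\xi\in\mathbb{H}^{n\times p}\mid \xi^HGX+X^HG\xi=0\}.$$ Furthermore, if $X_\perp\in\mathbb{H}^{n\times(n-p)}$ is an arbitrary matrix satisfying $X_\perp^HGX_\perp=I_{n-p}$ and $X^HGX_\perp=0$, then $$T_X\mathrm{St}_G(p,\mathbb{H}^n)=\{XB+X_\perp C\mid B\in\mathrm{Skew}(p),\ C\in\mathbb{H}^{(n-p)\times p}\}.$$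
   Context: $\mathbb{H}$ denotes the quaternions $q=q_0+q_1i+q_2j+q_3k$ with conjugate $\bar q=q_0-q_1i-q_2j-q_3k$; for a quaternionic matrix $A$, $A^H=\bar A^{\top}$ is the conjugate transpose. $G\in\mathbb{H}^{n\times n}$ is Hermitian positive definite if $G^H=G$ and $x^HGx>0$ for every nonzero $x\in\mathbb{H}^n$. $\mathrm{Skew}(p)=\{B\in\mathbb{H}^{p\times p}\mid B^H=-B\}$. $\mathbb{H}^{n\times p}$ is regarded as a real vector space of dimension $4np$ via $A_0+A_1i+A_2j+A_3k\mapsto(A_0,A_1,A_2,A_3)\in(\mathbb{R}^{n\times p})^4$, and $\mathrm{St}_G(p,\mathbb{H}^n)$ is regarded as a real embedded submanifold of it; tangent spaces are identified with real linear subspaces of $\mathbb{H}^{n\times p}$. When $p=n$, $X_\perp$ is the empty $n\times 0$ matrix and the term $X_\perp C$ is absent. *)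

theory Defs
  imports "HOL-Analysis.Euclidean_Space" "Jordan_Normal_Form.Matrix"
begin

subsection \<open>Quaternions\<close>

datatype quat = Quat (qRe: real) (qI: real) (qJ: real) (qK: real)

lemma quat_eqI: "\<lbrakk>qRe x = qRe y; qI x = qI y; qJ x = qJ y; qK x = qK y\<rbrakk> \<Longrightarrow> x = y"
  by (cases x; cases y) simp

lemma quat_eq_iff: "x = y \<longleftrightarrow> qRe x = qRe y \<and> qI x = qI y \<and> qJ x = qJ y \<and> qK x = qK y"
  by (auto intro: quat_eqI)

instantiation quat :: real_algebra_1
begin

definition zero_quat :: quat where "0 = Quat 0 0 0 0"
definition one_quat :: quat where "1 = Quat 1 0 0 0"
definition plus_quat :: "quat \<Rightarrow> quat \<Rightarrow> quat" where
  "x + y = Quat (qRe x + qRe y) (qI x + qI y) (qJ x + qJ y) (qK x + qK y)"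
definition minus_quat :: "quat \<Rightarrow> quat \<Rightarrow> quat" where
  "x - y = Quat (qRe x - qRe y) (qI x - qI y) (qJ x - qJ y) (qK x - qK y)"
definition uminus_quat :: "quat \<Rightarrow> quat" where
  "- x = Quat (- qRe x) (- qI x) (- qJ x) (- qK x)"
definition times_quat :: "quat \<Rightarrow> quat \<Rightarrow> quat" where
  "x * y = Quat
     (qRe x * qRe y - qI x * qI y - qJ x * qJ y - qK x * qK y)
     (qRe x * qI y + qI x * qRe y + qJ x * qK y - qK x * qJ y)
     (qRe x * qJ y - qI x * qK y + qJ x * qRe y + qK x * qI y)
     (qRe x * qK y + qI x * qJ y - qJ x * qI y + qK x * qRe y)"
definition scaleR_quat :: "real \<Rightarrow> quat \<Rightarrow> quat" where
  "scaleR r x = Quat (r * qRe x) (r * qI x) (r * qJ x) (r * qK x)"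

instance
  by standard (simp_all add: zero_quat_def one_quat_def plus_quat_def minus_quat_def
      uminus_quat_def times_quat_def scaleR_quat_def quat_eq_iff algebra_simps)

end

lemma quat_sel_simps [simp]:
  "qRe 0 = 0" "qI 0 = 0" "qJ 0 = 0" "qK 0 = 0"
  "qRe 1 = 1" "qI 1 = 0" "qJ 1 = 0" "qK 1 = 0"
  "qRe (x + y) = qRe x + qRe y" "qI (x + y) = qI x + qI y"
  "qJ (x + y) = qJ x + qJ y" "qK (x + y) = qK x + qK y"
  "qRe (x - y) = qRe x - qRe y" "qI (x - y) = qI x - qI y"
  "qJ (x - y) = qJ x - qJ y" "qK (x - y) = qK x - qK y"
  "qRe (- x) = - qRe x" "qI (- x) = - qI x" "qJ (- x) = - qJ x" "qK (- x) = - qK x"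
  "qRe (scaleR r x) = r * qRe x" "qI (scaleR r x) = r * qI x"
  "qJ (scaleR r x) = r * qJ x" "qK (scaleR r x) = r * qK x"
  by (simp_all add: zero_quat_def one_quat_def plus_quat_def minus_quat_def
      uminus_quat_def scaleR_quat_def)

definition qcnj :: "quat \<Rightarrow> quat" where
  "qcnj x = Quat (qRe x) (- qI x) (- qJ x) (- qK x)"

lemma qcnj_qcnj [simp]: "qcnj (qcnj x) = x"
  by (simp add: qcnj_def)

lemma qcnj_add: "qcnj (x + y) = qcnj x + qcnj y"
  by (simp add: qcnj_def quat_eq_iff)

lemma qcnj_mult: "qcnj (x * y) = qcnj y * qcnj x"
  by (simp add: qcnj_def times_quat_def algebra_simps)

text \<open>The Euclidean structure is that of \<open>\<real>\<^sup>4\<close> under the identification of \<open>Quat a b c d\<close>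
  with \<open>(a, b, c, d)\<close>.\<close>

instantiation quat :: real_inner
begin

definition inner_quat :: "quat \<Rightarrow> quat \<Rightarrow> real" where
  "inner x y = qRe x * qRe y + qI x * qI y + qJ x * qJ y + qK x * qK y"
definition norm_quat :: "quat \<Rightarrow> real" where
  "norm x = sqrt (inner x x)" for x :: quat
definition sgn_quat :: "quat \<Rightarrow> quat" where
  "sgn x = x /\<^sub>R norm x" for x :: quat
definition dist_quat :: "quat \<Rightarrow> quat \<Rightarrow> real" where
  "dist x y = norm (x - y)" for x y :: quat
definition uniformity_quat :: "(quat \<times> quat) filter" where
  "uniformity_quat = (INF e\<in>{0<..}. principal {(x, y). dist x y < e})"
definition open_quat :: "quat set \<Rightarrow> bool" where
  "open_quat U \<longleftrightarrow> (\<forall>x\<in>U. eventually (\<lambda>(x', y). x' = x \<longrightarrow> y \<in> U) uniformity)"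

instance
proof
  fix x y z :: quat and r :: real
  show "inner x y = inner y x"
    by (simp add: inner_quat_def mult.commute)
  show "inner (x + y) z = inner x z + inner y z"
    by (simp add: inner_quat_def distrib_right)
  show "inner (scaleR r x) y = r * inner x y"
    by (simp add: inner_quat_def distrib_left)
  show "0 \<le> inner x x"
    by (simp add: inner_quat_def)
  show "inner x x = 0 \<longleftrightarrow> x = 0"
    by (simp add: inner_quat_def quat_eq_iff add_nonneg_eq_0_iff)
qed (simp_all only: norm_quat_def sgn_quat_def dist_quat_def uniformity_quat_def open_quat_def)

end

instantiation quat :: euclidean_space
begin

definition Basis_quat :: "quat set" where
  "Basis = {Quat 1 0 0 0, Quat 0 1 0 0, Quat 0 0 1 0, Quat 0 0 0 1}"

instance
proof
  fix u v x :: quat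
  show "(Basis :: quat set) \<noteq> {}" "finite (Basis :: quat set)"
    by (simp_all add: Basis_quat_def)
  show "\<lbrakk>u \<in> Basis; v \<in> Basis\<rbrakk> \<Longrightarrow> inner u v = (if u = v then 1 else 0)"
    unfolding Basis_quat_def inner_quat_def by (elim insertE emptyE; simp)
  show "(\<forall>u\<in>Basis. inner x u = 0) \<longleftrightarrow> x = 0"
    unfolding Basis_quat_def quat_eq_iff[of x] by (auto simp: inner_quat_def)
qed

end

instantiation quat :: real_normed_div_algebra
begin

definition inverse_quat :: "quat \<Rightarrow> quat" where
  "inverse x = qcnj x /\<^sub>R inner x x" for x :: quat
definition divide_quat :: "quat \<Rightarrow> quat \<Rightarrow> quat" where
  "x div y = x * inverse y" for x y :: quat

instance
proof
  fix x y :: quat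
  have c: "qcnj z * z = of_real (inner z z)" "z * qcnj z = of_real (inner z z)" for z :: quat
    by (simp_all add: qcnj_def times_quat_def inner_quat_def of_real_def quat_eq_iff algebra_simps)
  show "x \<noteq> 0 \<Longrightarrow> inverse x * x = 1" "x \<noteq> 0 \<Longrightarrow> x * inverse x = 1"
    by (simp_all add: inverse_quat_def c of_real_def)
  show "x div y = x * inverse y"
    by (simp add: divide_quat_def)
  show "inverse (0 :: quat) = 0"
    by (simp add: inverse_quat_def)
  have "of_real (inner (x * y) (x * y)) = qcnj y * (qcnj x * x) * y"
    by (simp add: c(1)[symmetric] qcnj_mult mult.assoc)
  also have "\<dots> = of_real (inner x x * inner y y)"
    by (simp add: c(1) of_real_def)
  finally have "inner (x * y) (x * y) = inner x x * inner y y"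
    by (simp only: of_real_eq_iff)
  then show "norm (x * y) = norm x * norm y"
    by (simp add: norm_quat_def real_sqrt_mult)
qed

end


subsection \<open>Quaternionic matrices\<close>

definition mat_herm :: "quat mat \<Rightarrow> quat mat"  (\<open>(_\<^sup>H)\<close> [1000] 1000) where
  "A\<^sup>H = map_mat qcnj (transpose_mat A)"

text \<open>As \<open>\<real>\<close> is central in the quaternions, \<open>x\<^sup>H G x > 0\<close> is read as: the quaternion
  \<open>x\<^sup>H G x\<close> is a real number and that number is positive.\<close>

definition hermitian_pos_def :: "nat \<Rightarrow> quat mat \<Rightarrow> bool" where
  "hermitian_pos_def n G \<longleftrightarrow> G \<in> carrier_mat n n \<and> G\<^sup>H = G \<and>
     (\<forall>x \<in> carrier_vec n. x \<noteq> 0\<^sub>v n \<longrightarrow>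
        (\<exists>r>0. scalar_prod (map_vec qcnj x) (G *\<^sub>v x) = of_real r))"

definition skew :: "nat \<Rightarrow> quat mat set" where
  "skew p = {B \<in> carrier_mat p p. B\<^sup>H = - B}"

definition stiefel :: "quat mat \<Rightarrow> nat \<Rightarrow> nat \<Rightarrow> quat mat set" where
  "stiefel G p n = {X \<in> carrier_mat n p. X\<^sup>H * G * X = 1\<^sub>m p}"


subsection \<open>Tangent spaces of submanifolds of a matrix space\<close>

text \<open>The type of matrices carries no topology, as the dimensions are not part of the type;
  derivatives of curves in \<open>carrier_mat n p\<close> are therefore taken entrywise.\<close>

definition has_mat_derivative ::
  "nat \<Rightarrow> nat \<Rightarrow> (real \<Rightarrow> 'a::real_normed_vector mat) \<Rightarrow> 'a mat \<Rightarrow> real \<Rightarrow> bool" where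
  "has_mat_derivative n p \<gamma> D t \<longleftrightarrow> D \<in> carrier_mat n p \<and>
     (\<forall>i<n. \<forall>j<p. ((\<lambda>s. \<gamma> s $$ (i, j)) has_vector_derivative D $$ (i, j)) (at t))"

text \<open>\<open>C\<^sup>\<infinity>\<close> curves in \<open>carrier_mat n p\<close> on an open set \<open>I\<close> of parameters;
  \<open>D k\<close> is the \<open>k\<close>-th derivative.\<close>

definition smooth_mat_curve_on ::
  "nat \<Rightarrow> nat \<Rightarrow> real set \<Rightarrow> (real \<Rightarrow> 'a::real_normed_vector mat) \<Rightarrow> bool" where
  "smooth_mat_curve_on n p I \<gamma> \<longleftrightarrow> (\<forall>t\<in>I. \<gamma> t \<in> carrier_mat n p) \<and>
     (\<exists>D. D 0 = \<gamma> \<and> (\<forall>k. \<forall>t\<in>I. has_mat_derivative n p (D k) (D (Suc k) t) t))"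

text \<open>For an embedded submanifold \<open>S\<close> of \<open>carrier_mat n p\<close>, the tangent space at \<open>X\<close> is the set of
  velocities at \<open>X\<close> of smooth curves that run in \<open>S\<close>.\<close>

definition tangent_space ::
  "nat \<Rightarrow> nat \<Rightarrow> 'a::real_normed_vector mat set \<Rightarrow> 'a mat \<Rightarrow> 'a mat set" where
  "tangent_space n p S X = {\<xi>. \<exists>\<epsilon>>0. \<exists>\<gamma>.
     smooth_mat_curve_on n p {-\<epsilon><..<\<epsilon>} \<gamma> \<and> (\<forall>t\<in>{-\<epsilon><..<\<epsilon>}. \<gamma> t \<in> S) \<and>
     \<gamma> 0 = X \<and> has_mat_derivative n p \<gamma> \<xi> 0}"

end

theory Submission
  imports Defs "HOL-Analysis.Derivative"
begin

text \<open>
  Differentiating \<open>\<gamma>\<^sup>H G \<gamma> = I\<close> along a curve in the Stiefel manifold gives the linearised equation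
  \<open>\<xi>\<^sup>H G X + X\<^sup>H G \<xi> = 0\<close> for its velocity, so tangent vectors solve it
  (\<open>tangent_vector_satisfies_linearised_equation\<close>).

  Conversely, a solution \<open>\<xi>\<close> has to be realised as the velocity of a smooth curve. The group that
  preserves the form \<open>x\<^sup>H G x\<close> acts on the manifold, and suitable curves in it are the Cayley
  transforms \<open>(I - t V)\<^sup>-\<^sup>1 (I + t V)\<close> with \<open>V\<^sup>H G = - G V\<close>; the orbit of \<open>X\<close> leaves with
  velocity \<open>2 V X\<close>. So it suffices to have such a \<open>V\<close> with \<open>V X = \<xi> / 2\<close>, and an explicit formula for
  one is available exactly when \<open>\<xi>\<close> solves the linearised equation (\<open>skew_generator\<close>). The inverse
  enters only through \<open>Y = (I - t V)\<^sup>-\<^sup>1 X\<close>, which for small \<open>t\<close> is the entrywise convergent Neumann series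
  \<open>\<Sum>k. t\<^sup>k V\<^sup>k X\<close>; being a power series it is smooth (\<open>resolvent_curve\<close>). Putting \<open>Z = t V Y\<close>, one has
  \<open>X = Y - Z\<close>, the curve is \<open>Y + Z = 2 Y - X\<close>, and these two have the same Gram matrix because the
  skewness of \<open>V\<close> cancels the mixed terms (\<open>sum_and_difference_isometric\<close>).

  For the second description, the \<open>n\<close> columns of \<open>X\<close> and \<open>X\<^sub>\<bottom>\<close> are orthonormal for \<open>G\<close>, hence
  linearly independent, hence they span: every \<open>\<xi>\<close> is \<open>X B + X\<^sub>\<bottom> C\<close>. As \<open>X\<^sup>H G \<xi> = B\<close>, the linearised
  equation says \<open>B\<^sup>H + B = 0\<close>. That \<open>n\<close> independent columns span is the one fact of linear algebra over
  the skew field of quaternions that is used; it follows from Gaussian elimination, which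
  works over every division ring.
\<close>

section \<open>Homogeneous linear systems over a division ring\<close>

text \<open>
  Gaussian elimination: with the unknowns to the right of the coefficients, row operations act on the
  left and preserve the solutions also over a skew field. The
  unknowns are indexed by an arbitrary finite set, since eliminating one of them leaves no natural
  numbering of the others.
\<close>

lemma underdetermined_system_nontrivial_solution:
  fixes a :: "nat \<Rightarrow> 'b \<Rightarrow> 'a::division_ring"
  assumes "finite J" "m < card J"
  shows "\<exists>x. (\<exists>j\<in>J. x j \<noteq> 0) \<and> (\<forall>i<m. (\<Sum>j\<in>J. a i j * x j) = 0)"
  using assms
proof (induction m arbitrary: a J)
  case 0
  then obtain j where "j \<in> J" by fastforce
  then show ?case by (intro exI[of _ "\<lambda>_. 1"]) auto
next
  case (Suc m)
  show ?case
  proof (cases "\<forall>j\<in>J. a m j = 0")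
    case True
    from Suc.IH[of J a] Suc.prems obtain x where
      x: "\<exists>j\<in>J. x j \<noteq> 0" "\<forall>i<m. (\<Sum>j\<in>J. a i j * x j) = 0" by auto
    from True have "(\<Sum>j\<in>J. a m j * x j) = 0" by simp
    with x show ?thesis by (intro exI[of _ x]) (auto simp: less_Suc_eq)
  next
    case False
    then obtain l where l: "l \<in> J" "a m l \<noteq> 0" by blast
    define K where "K = J - {l}"
    have K: "finite K" "l \<notin> K" "J = insert l K" "m < card K"
      using Suc.prems l by (auto simp: K_def card_Diff_singleton)
    \<comment> \<open>Row \<open>m\<close>, with pivot \<open>l\<close>, is subtracted from the rows above it to remove the unknown \<open>l\<close>.\<close>
    define b where "b i j = a i j - a i l * (inverse (a m l) * a m j)" for i j
    from Suc.IH[OF K(1,4), of b] obtain x where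
      x: "\<exists>j\<in>K. x j \<noteq> 0" "\<forall>i<m. (\<Sum>j\<in>K. b i j * x j) = 0" by blast
    define s where "s = (\<Sum>j\<in>K. a m j * x j)"
    \<comment> \<open>The value at \<open>l\<close> is the one that makes equation \<open>m\<close> hold.\<close>
    define y where "y = x(l := - (inverse (a m l) * s))"
    have sum_y: "(\<Sum>j\<in>J. a i j * y j) = (\<Sum>j\<in>K. a i j * x j) - a i l * (inverse (a m l) * s)" for i
    proof -
      have "(\<Sum>j\<in>J. a i j * y j) = a i l * y l + (\<Sum>j\<in>K. a i j * y j)"
        using K by simp
      also have "(\<Sum>j\<in>K. a i j * y j) = (\<Sum>j\<in>K. a i j * x j)"
        using K(2) by (intro sum.cong) (auto simp: y_def)
      finally show ?thesis by (simp add: y_def)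
    qed
    have "(\<Sum>j\<in>J. a m j * y j) = 0"
      using l(2) unfolding sum_y by (simp add: s_def mult.assoc[symmetric])
    moreover have "(\<Sum>j\<in>J. a i j * y j) = 0" if "i < m" for i
    proof -
      have "(\<Sum>j\<in>K. b i j * x j) = (\<Sum>j\<in>K. a i j * x j) - a i l * (inverse (a m l) * s)"
        by (simp add: b_def s_def algebra_simps sum_subtractf sum_distrib_left)
      with x(2) that show ?thesis by (simp add: sum_y)
    qed
    moreover have "\<exists>j\<in>J. y j \<noteq> 0" using x(1) K by (auto simp: y_def)
    ultimately show ?thesis by (intro exI[of _ y]) (auto simp: less_Suc_eq)
  qed
qed

text \<open>
  Adjoining \<open>v\<close> as one more column, with index \<open>None\<close>, makes the system underdetermined. In a nontrivial
  relation the coefficient of \<open>v\<close> cannot vanish by independence, and so can be divided out.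
\<close>

lemma independent_columns_span:
  fixes a :: "nat \<Rightarrow> 'b \<Rightarrow> 'a::division_ring"
  assumes J: "finite J" "card J = n"
    and indep: "\<And>x. (\<And>i. i < n \<Longrightarrow> (\<Sum>j\<in>J. a i j * x j) = 0) \<Longrightarrow> \<forall>j\<in>J. x j = 0"
  shows "\<exists>x. \<forall>i<n. (\<Sum>j\<in>J. a i j * x j) = v i"
proof -
  define K where "K = insert None (Some ` J)"
  have K: "finite K" "n < card K"
    using J by (auto simp: K_def card_image)
  define b where "b i = case_option (v i) (a i)" for i
  have sumK: "(\<Sum>k\<in>K. b i k * x k) = v i * x None + (\<Sum>j\<in>J. a i j * x (Some j))" for i x
    using J by (simp add: K_def b_def sum.reindex)
  from underdetermined_system_nontrivial_solution[OF K, of b] obtain x where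
    x: "\<exists>k\<in>K. x k \<noteq> 0" "\<And>i. i < n \<Longrightarrow> v i * x None + (\<Sum>j\<in>J. a i j * x (Some j)) = 0"
    unfolding sumK by blast
  have nz: "x None \<noteq> 0"
  proof
    assume "x None = 0"
    with x(2) indep[of "\<lambda>j. x (Some j)"] have "\<forall>j\<in>J. x (Some j) = 0" by simp
    with x(1) \<open>x None = 0\<close> show False by (auto simp: K_def)
  qed
  show ?thesis
  proof (intro exI[of _ "\<lambda>j. - (x (Some j) * inverse (x None))"] allI impI)
    fix i assume "i < n"
    have "(\<Sum>j\<in>J. a i j * - (x (Some j) * inverse (x None)))
        = - (\<Sum>j\<in>J. a i j * x (Some j)) * inverse (x None)"
      by (simp add: sum_distrib_right sum_negf mult.assoc)
    also have "- (\<Sum>j\<in>J. a i j * x (Some j)) = v i * x None"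
      using x(2)[OF \<open>i < n\<close>] by (simp add: add_eq_0_iff)
    finally show "(\<Sum>j\<in>J. a i j * - (x (Some j) * inverse (x None))) = v i"
      using nz by (simp add: mult.assoc)
  qed
qed

lemma index_mult_mat_sum:
  assumes "A \<in> carrier_mat n m" "B \<in> carrier_mat m p" "i < n" "j < p"
  shows "(A * B) $$ (i, j) = (\<Sum>l<m. A $$ (i, l) * B $$ (l, j))"
  using assms by (auto simp: scalar_prod_def lessThan_atLeast0 intro!: sum.cong)

text \<open>
  The matrix form of the previous lemma for the block matrix \<open>(A | B)\<close>. The columns of the two blocks are
  indexed by a disjoint sum, and the coefficients of each column of \<open>M\<close> become a column of \<open>C\<close> and of \<open>D\<close>.
\<close>

lemma columns_span:
  fixes A B M :: "'a::division_ring mat"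
  assumes A: "A \<in> carrier_mat n p" and B: "B \<in> carrier_mat n q" and "p + q = n"
    and M: "M \<in> carrier_mat n r"
    and indep: "\<And>x y. \<lbrakk>x \<in> carrier_mat p 1; y \<in> carrier_mat q 1; A * x + B * y = 0\<^sub>m n 1\<rbrakk>
      \<Longrightarrow> x = 0\<^sub>m p 1 \<and> y = 0\<^sub>m q 1"
  obtains C D where "C \<in> carrier_mat p r" "D \<in> carrier_mat q r" "M = A * C + B * D"
proof -
  define J where "J = {..<p} <+> {..<q}"
  define a where "a i = case_sum (\<lambda>l. A $$ (i, l)) (\<lambda>l. B $$ (i, l))" for i
  have J: "finite J" "card J = n"
    using \<open>p + q = n\<close> by (auto simp: J_def card_Plus)
  have sumJ: "(\<Sum>j\<in>J. a i j * z j) = (\<Sum>l<p. A $$ (i, l) * z (Inl l)) + (\<Sum>l<q. B $$ (i, l) * z (Inr l))"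
    for i z
    by (simp add: J_def a_def sum.Plus)
  have "\<exists>z. \<forall>i<n. (\<Sum>j\<in>J. a i j * z j) = M $$ (i, k)" for k
  proof (rule independent_columns_span[OF J])
    fix z assume z: "\<And>i. i < n \<Longrightarrow> (\<Sum>j\<in>J. a i j * z j) = 0"
    define x where "x = Matrix.mat p 1 (\<lambda>(l, _). z (Inl l))"
    define y where "y = Matrix.mat q 1 (\<lambda>(l, _). z (Inr l))"
    have xy: "x \<in> carrier_mat p 1" "y \<in> carrier_mat q 1" by (auto simp: x_def y_def)
    have "A * x + B * y = 0\<^sub>m n 1"
    proof (rule eq_matI)
      fix i j assume "i < dim_row (0\<^sub>m n 1 :: 'a mat)" "j < dim_col (0\<^sub>m n 1 :: 'a mat)"
      then have ij: "i < n" "j < 1" by auto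
      have "(A * x + B * y) $$ (i, j) = (A * x) $$ (i, j) + (B * y) $$ (i, j)"
        using A B xy ij by (intro index_add_mat) auto
      also have "\<dots> = (\<Sum>j\<in>J. a i j * z j)"
        unfolding sumJ index_mult_mat_sum[OF A xy(1) ij] index_mult_mat_sum[OF B xy(2) ij]
        using ij by (intro arg_cong2[of _ _ _ _ "(+)"] sum.cong) (auto simp: x_def y_def)
      finally show "(A * x + B * y) $$ (i, j) = (0\<^sub>m n 1) $$ (i, j)"
        using z ij by simp
    qed (use A B xy in auto)
    from indep[OF xy this] have *: "x = 0\<^sub>m p 1" "y = 0\<^sub>m q 1" by auto
    have "z (Inl l) = 0" if "l < p" for l
      using that arg_cong[OF *(1), of "\<lambda>m. m $$ (l, 0)"] by (simp add: x_def)
    moreover have "z (Inr l) = 0" if "l < q" for l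
      using that arg_cong[OF *(2), of "\<lambda>m. m $$ (l, 0)"] by (simp add: y_def)
    ultimately show "\<forall>j\<in>J. z j = 0" by (auto simp: J_def)
  qed
  then obtain z where z: "\<And>i k. i < n \<Longrightarrow> (\<Sum>j\<in>J. a i j * z k j) = M $$ (i, k)"
    by metis
  define C where "C = Matrix.mat p r (\<lambda>(l, k). z k (Inl l))"
  define D where "D = Matrix.mat q r (\<lambda>(l, k). z k (Inr l))"
  have CD: "C \<in> carrier_mat p r" "D \<in> carrier_mat q r" by (auto simp: C_def D_def)
  have "M = A * C + B * D"
  proof (rule eq_matI)
    fix i k assume "i < dim_row (A * C + B * D)" "k < dim_col (A * C + B * D)"
    then have ik: "i < n" "k < r" using B CD by auto
    have "M $$ (i, k) = (A * C) $$ (i, k) + (B * D) $$ (i, k)"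
      unfolding z[OF ik(1), symmetric] sumJ
        index_mult_mat_sum[OF A CD(1) ik] index_mult_mat_sum[OF B CD(2) ik]
      using ik by (intro arg_cong2[of _ _ _ _ "(+)"] sum.cong) (auto simp: C_def D_def)
    then show "M $$ (i, k) = (A * C + B * D) $$ (i, k)"
      using A B CD ik by simp
  qed (use A B CD M in auto)
  with CD that show thesis by blast
qed


section \<open>Conjugate transposes\<close>

lemma mat_herm_carrier [simp]: "A\<^sup>H \<in> carrier_mat p n \<longleftrightarrow> A \<in> carrier_mat n p"
  by (auto simp: mat_herm_def)

lemma index_mat_herm [simp]:
  "i < dim_col A \<Longrightarrow> j < dim_row A \<Longrightarrow> A\<^sup>H $$ (i, j) = qcnj (A $$ (j, i))"
  "dim_row A\<^sup>H = dim_col A" "dim_col A\<^sup>H = dim_row A"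
  by (auto simp: mat_herm_def)

lemma linear_qcnj: "linear qcnj"
  by (rule linearI) (auto simp: qcnj_def quat_eq_iff)

lemma mat_herm_herm [simp]: "(A\<^sup>H)\<^sup>H = A"
  by (rule eq_matI) auto

lemma mat_herm_zero [simp]: "(0\<^sub>m n p)\<^sup>H = 0\<^sub>m p n"
  by (rule eq_matI) (auto simp: linear_0[OF linear_qcnj])

lemma mat_herm_add:
  "A \<in> carrier_mat n p \<Longrightarrow> B \<in> carrier_mat n p \<Longrightarrow> (A + B)\<^sup>H = A\<^sup>H + B\<^sup>H"
  by (rule eq_matI) (auto simp: qcnj_add)

lemma mat_herm_minus:
  "A \<in> carrier_mat n p \<Longrightarrow> B \<in> carrier_mat n p \<Longrightarrow> (A - B)\<^sup>H = A\<^sup>H - B\<^sup>H"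
  by (rule eq_matI) (auto simp: linear_diff[OF linear_qcnj])

lemma mat_herm_scale: "(map_mat ((*\<^sub>R) c) A)\<^sup>H = map_mat ((*\<^sub>R) c) A\<^sup>H"
  by (rule eq_matI) (auto simp: linear_scale[OF linear_qcnj])

lemma mat_herm_mult:
  assumes "A \<in> carrier_mat n m" "B \<in> carrier_mat m p"
  shows "(A * B)\<^sup>H = B\<^sup>H * A\<^sup>H"
proof (rule eq_matI)
  fix i j assume "i < dim_row (B\<^sup>H * A\<^sup>H)" "j < dim_col (B\<^sup>H * A\<^sup>H)"
  then have ij: "i < p" "j < n" using assms by auto
  have "(A * B)\<^sup>H $$ (i, j) = qcnj ((A * B) $$ (j, i))"
    using assms ij by (intro index_mat_herm) auto
  also have "\<dots> = (\<Sum>l<m. qcnj (A $$ (j, l) * B $$ (l, i)))"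
    unfolding index_mult_mat_sum[OF assms ij(2,1)] by (rule linear_sum[OF linear_qcnj])
  also have "\<dots> = (\<Sum>l<m. B\<^sup>H $$ (i, l) * A\<^sup>H $$ (l, j))"
    using assms ij by (intro sum.cong) (auto simp: qcnj_mult)
  also have "\<dots> = (B\<^sup>H * A\<^sup>H) $$ (i, j)"
    using assms ij by (subst index_mult_mat_sum[of _ p m _ n]) auto
  finally show "(A * B)\<^sup>H $$ (i, j) = (B\<^sup>H * A\<^sup>H) $$ (i, j)" .
qed (use assms in auto)

lemma mult_scale_mat:
  fixes A B :: "'a::real_algebra_1 mat"
  assumes "A \<in> carrier_mat n m" "B \<in> carrier_mat m p"
  shows "A * map_mat ((*\<^sub>R) c) B = map_mat ((*\<^sub>R) c) (A * B)"
    and "map_mat ((*\<^sub>R) c) A * B = map_mat ((*\<^sub>R) c) (A * B)"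
  using assms by (auto intro!: eq_matI simp: scalar_prod_def scaleR_sum_right)

lemma sesquilinear_herm:
  assumes "G \<in> carrier_mat n n" "G\<^sup>H = G" "A \<in> carrier_mat n p" "B \<in> carrier_mat n q"
  shows "(A\<^sup>H * G * B)\<^sup>H = B\<^sup>H * G * A"
  using assms
  by (simp add: mat_herm_mult[of _ p n _ q] mat_herm_mult[of _ n n _ q] mat_herm_mult[of _ p n _ n]
      assoc_mult_mat[of _ q n _ n _ p])


section \<open>Derivatives of matrix curves\<close>

lemma has_mat_derivative_const:
  "A \<in> carrier_mat n p \<Longrightarrow> has_mat_derivative n p (\<lambda>_. A) (0\<^sub>m n p) t"
  by (auto simp: has_mat_derivative_def)

lemma has_mat_derivative_unique:
  assumes "has_mat_derivative n p \<gamma> D t" "has_mat_derivative n p \<gamma> E t"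
  shows "D = E"
proof (rule eq_matI)
  show "dim_row D = dim_row E" "dim_col D = dim_col E"
    using assms by (auto simp: has_mat_derivative_def)
  fix i j assume "i < dim_row E" "j < dim_col E"
  then have "i < n" "j < p" using assms(2) by (auto simp: has_mat_derivative_def)
  with assms show "D $$ (i, j) = E $$ (i, j)"
    using vector_derivative_unique_at[of "\<lambda>s. \<gamma> s $$ (i, j)"]
    unfolding has_mat_derivative_def by blast
qed

text \<open>
  Entries of a matrix are unspecified outside its dimensions, and a curve in a submanifold has known
  dimensions only for parameters in an interval. Derivatives of products and conjugate transposes are
  therefore computed on an open set of parameters where the dimensions are known.
\<close>

lemma has_mat_derivative_transform:
  assumes "has_mat_derivative n p \<gamma> D t" "open I" "t \<in> I" "\<And>s. s \<in> I \<Longrightarrow> \<gamma> s = \<delta> s"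
  shows "has_mat_derivative n p \<delta> D t"
  unfolding has_mat_derivative_def
proof (intro conjI allI impI)
  fix i j assume "i < n" "j < p"
  then have "((\<lambda>s. \<gamma> s $$ (i, j)) has_vector_derivative D $$ (i, j)) (at t)"
    using assms(1) by (auto simp: has_mat_derivative_def)
  then show "((\<lambda>s. \<delta> s $$ (i, j)) has_vector_derivative D $$ (i, j)) (at t)"
    by (rule has_vector_derivative_transform_within_open[OF _ assms(2,3)]) (simp add: assms(4))
qed (use assms in \<open>auto simp: has_mat_derivative_def\<close>)

lemma has_mat_derivative_mult:
  fixes \<gamma> \<delta> :: "real \<Rightarrow> 'a::real_normed_algebra_1 mat"
  assumes I: "open I" "t \<in> I"
    and \<gamma>: "\<And>s. s \<in> I \<Longrightarrow> \<gamma> s \<in> carrier_mat n m" "has_mat_derivative n m \<gamma> D t"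
    and \<delta>: "\<And>s. s \<in> I \<Longrightarrow> \<delta> s \<in> carrier_mat m p" "has_mat_derivative m p \<delta> E t"
  shows "has_mat_derivative n p (\<lambda>s. \<gamma> s * \<delta> s) (D * \<delta> t + \<gamma> t * E) t"
  unfolding has_mat_derivative_def
proof (intro conjI allI impI)
  have D: "D \<in> carrier_mat n m" and E: "E \<in> carrier_mat m p"
    using \<gamma> \<delta> by (auto simp: has_mat_derivative_def)
  note \<gamma>t = \<gamma>(1)[OF I(2)] and \<delta>t = \<delta>(1)[OF I(2)]
  show "D * \<delta> t + \<gamma> t * E \<in> carrier_mat n p"
    using D E \<gamma>t \<delta>t by auto
  fix i j assume ij: "i < n" "j < p"
  have "((\<lambda>s. \<Sum>l<m. \<gamma> s $$ (i, l) * \<delta> s $$ (l, j)) has_vector_derivative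
      (\<Sum>l<m. \<gamma> t $$ (i, l) * E $$ (l, j) + D $$ (i, l) * \<delta> t $$ (l, j))) (at t)"
    using \<gamma>(2) \<delta>(2) ij
    by (intro has_vector_derivative_sum has_vector_derivative_mult) (auto simp: has_mat_derivative_def)
  also have "(\<Sum>l<m. \<gamma> t $$ (i, l) * E $$ (l, j) + D $$ (i, l) * \<delta> t $$ (l, j))
      = (D * \<delta> t + \<gamma> t * E) $$ (i, j)"
    using D E \<gamma>t \<delta>t ij
      index_mult_mat_sum[OF D \<delta>t ij] index_mult_mat_sum[OF \<gamma>t E ij]
    by (simp add: sum.distrib)
  finally show "((\<lambda>s. (\<gamma> s * \<delta> s) $$ (i, j)) has_vector_derivative (D * \<delta> t + \<gamma> t * E) $$ (i, j)) (at t)"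
    by (rule has_vector_derivative_transform_within_open[OF _ I])
      (simp only: index_mult_mat_sum[OF \<gamma>(1) \<delta>(1) ij])
qed

lemma has_mat_derivative_herm:
  assumes I: "open I" "t \<in> I"
    and \<gamma>: "\<And>s. s \<in> I \<Longrightarrow> \<gamma> s \<in> carrier_mat n p" "has_mat_derivative n p \<gamma> D t"
  shows "has_mat_derivative p n (\<lambda>s. (\<gamma> s)\<^sup>H) (D\<^sup>H) t"
  unfolding has_mat_derivative_def
proof (intro conjI allI impI)
  have D: "D \<in> carrier_mat n p" using \<gamma> by (auto simp: has_mat_derivative_def)
  then show "D\<^sup>H \<in> carrier_mat p n" by simp
  fix i j assume ij: "i < p" "j < n"
  have "bounded_linear qcnj"
    using linear_qcnj linear_conv_bounded_linear by blast
  from bounded_linear.has_vector_derivative[OF this]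
  have "((\<lambda>s. qcnj (\<gamma> s $$ (j, i))) has_vector_derivative qcnj (D $$ (j, i))) (at t)"
    using \<gamma>(2) ij by (auto simp: has_mat_derivative_def)
  moreover have "qcnj (D $$ (j, i)) = D\<^sup>H $$ (i, j)"
    using D ij by auto
  moreover have "qcnj (\<gamma> s $$ (j, i)) = (\<gamma> s)\<^sup>H $$ (i, j)" if "s \<in> I" for s
    using \<gamma>(1)[OF that] ij by auto
  ultimately show "((\<lambda>s. (\<gamma> s)\<^sup>H $$ (i, j)) has_vector_derivative D\<^sup>H $$ (i, j)) (at t)"
    using has_vector_derivative_transform_within_open[OF _ I] by fastforce
qed

lemma has_mat_derivative_add_self:
  assumes "\<And>s. \<gamma> s \<in> carrier_mat n p" "has_mat_derivative n p \<gamma> D t"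
  shows "has_mat_derivative n p (\<lambda>s. \<gamma> s + \<gamma> s) (D + D) t"
  unfolding has_mat_derivative_def
proof (intro conjI allI impI)
  show "D + D \<in> carrier_mat n p" using assms(2) by (simp add: has_mat_derivative_def)
  fix i j assume ij: "i < n" "j < p"
  then have "((\<lambda>s. \<gamma> s $$ (i, j)) has_vector_derivative D $$ (i, j)) (at t)"
    using assms(2) by (simp add: has_mat_derivative_def)
  from has_vector_derivative_add[OF this this]
  have "((\<lambda>s. \<gamma> s $$ (i, j) + \<gamma> s $$ (i, j)) has_vector_derivative D $$ (i, j) + D $$ (i, j)) (at t)" .
  moreover have "D \<in> carrier_mat n p" using assms(2) by (simp add: has_mat_derivative_def)
  ultimately show "((\<lambda>s. (\<gamma> s + \<gamma> s) $$ (i, j)) has_vector_derivative (D + D) $$ (i, j)) (at t)"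
    using assms(1) ij by (simp add: carrier_matD[OF assms(1)])
qed

lemma has_mat_derivative_minus_const:
  assumes "X \<in> carrier_mat n p" "has_mat_derivative n p \<gamma> D t"
  shows "has_mat_derivative n p (\<lambda>s. \<gamma> s - X) D t"
  using assms by (simp add: has_mat_derivative_def has_vector_derivative_diff_const)


section \<open>Power series in a matrix\<close>

text \<open>
  Termwise differentiation of a power series in one real variable with coefficients in a Euclidean space,
  obtained from the scalar case in each coordinate. The derived series converges on the same interval,
  so the lemma can be iterated.
\<close>

lemma vector_power_series_has_vector_derivative:
  fixes c :: "nat \<Rightarrow> 'a::euclidean_space"
  assumes summ: "\<And>t. \<bar>t\<bar> < r \<Longrightarrow> summable (\<lambda>n. t ^ n *\<^sub>R c n)" and t: "\<bar>t\<bar> < r"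
  shows "summable (\<lambda>n. t ^ n *\<^sub>R (real (Suc n) *\<^sub>R c (Suc n)))"
    and "((\<lambda>t. \<Sum>n. t ^ n *\<^sub>R c n) has_vector_derivative
           (\<Sum>n. t ^ n *\<^sub>R (real (Suc n) *\<^sub>R c (Suc n)))) (at t)"
proof -
  have real_summ: "summable (\<lambda>n. (c n \<bullet> b) * s ^ n)" if "norm s < r" for s b
    using bounded_linear.summable[OF bounded_linear_inner_left summ[of s], of b] that
    by (simp add: mult.commute)
  have diffs_eq: "diffs (\<lambda>n. c n \<bullet> b) n * s ^ n = s ^ n *\<^sub>R (real (Suc n) *\<^sub>R c (Suc n)) \<bullet> b" for b n s
    by (simp add: diffs_def)
  have comp_summ: "summable (\<lambda>n. s ^ n *\<^sub>R (real (Suc n) *\<^sub>R c (Suc n)) \<bullet> b)" if "\<bar>s\<bar> < r" for s b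
    using termdiff_converges[of s r "\<lambda>n. c n \<bullet> b"] real_summ that
    unfolding diffs_eq by auto
  show summ': "summable (\<lambda>n. t ^ n *\<^sub>R (real (Suc n) *\<^sub>R c (Suc n)))"
  proof -
    have "summable (\<lambda>n. \<Sum>b\<in>Basis. (t ^ n *\<^sub>R (real (Suc n) *\<^sub>R c (Suc n)) \<bullet> b) *\<^sub>R b)"
      using bounded_linear.summable[OF bounded_linear_scaleR_left comp_summ[OF t]]
      by (intro summable_sum) blast
    then show ?thesis by (simp only: euclidean_representation)
  qed
  show "((\<lambda>t. \<Sum>n. t ^ n *\<^sub>R c n) has_vector_derivative
           (\<Sum>n. t ^ n *\<^sub>R (real (Suc n) *\<^sub>R c (Suc n)))) (at t)"
    unfolding has_vector_derivative_def
  proof (subst has_derivative_componentwise_within, rule ballI)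
    fix b :: 'a
    have "((\<lambda>s. \<Sum>n. (c n \<bullet> b) * s ^ n) has_vector_derivative (\<Sum>n. diffs (\<lambda>n. c n \<bullet> b) n * t ^ n)) (at t)"
      unfolding has_real_derivative_iff_has_vector_derivative[symmetric]
      using real_summ t by (intro termdiffs_strong'[of r]) auto
    also have "(\<Sum>n. diffs (\<lambda>n. c n \<bullet> b) n * t ^ n) = (\<Sum>n. t ^ n *\<^sub>R (real (Suc n) *\<^sub>R c (Suc n))) \<bullet> b"
      unfolding diffs_eq by (rule bounded_linear.suminf[OF bounded_linear_inner_left summ', symmetric])
    finally have "((\<lambda>s. (\<Sum>n. s ^ n *\<^sub>R c n) \<bullet> b) has_vector_derivative
        (\<Sum>n. t ^ n *\<^sub>R (real (Suc n) *\<^sub>R c (Suc n))) \<bullet> b) (at t)"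
    proof (rule has_vector_derivative_transform_within_open[of _ _ _ "{-r<..<r}"])
      fix s assume "s \<in> {-r<..<r}"
      then have "\<bar>s\<bar> < r" by auto
      from bounded_linear.suminf[OF bounded_linear_inner_left summ[OF this], of b]
      show "(\<Sum>n. (c n \<bullet> b) * s ^ n) = (\<Sum>n. s ^ n *\<^sub>R c n) \<bullet> b"
        by (simp add: mult.commute)
    qed (use t in auto)
    then show "((\<lambda>s. (\<Sum>n. s ^ n *\<^sub>R c n) \<bullet> b) has_derivative
        (\<lambda>x. (x *\<^sub>R (\<Sum>n. t ^ n *\<^sub>R (real (Suc n) *\<^sub>R c (Suc n)))) \<bullet> b)) (at t)"
      by (simp add: has_vector_derivative_def)
  qed
qed

definition mat_power_series :: "nat \<Rightarrow> nat \<Rightarrow> (nat \<Rightarrow> 'a::real_normed_vector mat) \<Rightarrow> real \<Rightarrow> 'a mat" where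
  "mat_power_series n p C t = Matrix.mat n p (\<lambda>ij. \<Sum>k. t ^ k *\<^sub>R C k $$ ij)"

lemma mat_power_series_carrier [simp]: "mat_power_series n p C t \<in> carrier_mat n p"
  by (simp add: mat_power_series_def)

lemma mat_power_series_at_zero:
  assumes "C 0 \<in> carrier_mat n p"
  shows "mat_power_series n p C 0 = C 0"
proof (rule eq_matI)
  fix i j assume "i < dim_row (C 0)" "j < dim_col (C 0)"
  then show "mat_power_series n p C 0 $$ (i, j) = C 0 $$ (i, j)"
    using assms suminf_finite[of "{0}" "\<lambda>k. (0 :: real) ^ k *\<^sub>R C k $$ (i, j)"]
    by (simp add: mat_power_series_def)
qed (use assms in \<open>auto simp: mat_power_series_def\<close>)

text \<open>
  Differentiation acts on the coefficients by \<open>B m \<mapsto> (m + 1) B (m + 1)\<close>; the iterates of this shift give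
  all derivatives at once, and their convergence is carried along the iteration.
\<close>

lemma smooth_mat_power_series:
  fixes C :: "nat \<Rightarrow> 'a::euclidean_space mat"
  assumes carr: "\<And>k. C k \<in> carrier_mat n p"
    and summ: "\<And>t i j. \<lbrakk>\<bar>t\<bar> < r; i < n; j < p\<rbrakk> \<Longrightarrow> summable (\<lambda>k. t ^ k *\<^sub>R C k $$ (i, j))"
  obtains D where "D 0 = mat_power_series n p C" "D 1 0 = C 1"
    "\<And>k t. D k t \<in> carrier_mat n p"
    "\<And>k t. \<bar>t\<bar> < r \<Longrightarrow> has_mat_derivative n p (D k) (D (Suc k) t) t"
proof -
  define shift :: "(nat \<Rightarrow> 'a mat) \<Rightarrow> nat \<Rightarrow> 'a mat"
    where "shift = (\<lambda>B m. map_mat ((*\<^sub>R) (real (Suc m))) (B (Suc m)))"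
  define D where "D k = mat_power_series n p ((shift ^^ k) C)" for k
  have inv: "(\<forall>m. (shift ^^ k) C m \<in> carrier_mat n p) \<and>
      (\<forall>t i j. \<bar>t\<bar> < r \<longrightarrow> i < n \<longrightarrow> j < p \<longrightarrow> summable (\<lambda>m. t ^ m *\<^sub>R (shift ^^ k) C m $$ (i, j)))"
    (is "?car k \<and> ?sum k") for k
  proof (induction k)
    case 0
    then show ?case using carr summ by simp
  next
    case (Suc k)
    then have car: "?car k" and sum: "?sum k" by blast+
    have "?car (Suc k)" using car by (simp add: shift_def)
    moreover have "?sum (Suc k)"
    proof (intro allI impI)
      fix t i j assume *: "\<bar>t\<bar> < r" "i < n" "j < p"
      have "summable (\<lambda>m. t ^ m *\<^sub>R (real (Suc m) *\<^sub>R (shift ^^ k) C (Suc m) $$ (i, j)))"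
        using sum * by (intro vector_power_series_has_vector_derivative(1)[of r]) auto
      moreover have "(shift ^^ Suc k) C m $$ (i, j) = real (Suc m) *\<^sub>R (shift ^^ k) C (Suc m) $$ (i, j)" for m
        using car[rule_format, of "Suc m"] * by (simp add: shift_def)
      ultimately show "summable (\<lambda>m. t ^ m *\<^sub>R (shift ^^ Suc k) C m $$ (i, j))" by simp
    qed
    ultimately show ?case by blast
  qed
  have "D 0 = mat_power_series n p C" by (simp add: D_def)
  moreover have "D 1 0 = C 1"
  proof -
    have "shift C 0 = C 1" by (auto simp: shift_def intro!: eq_matI)
    then show ?thesis using mat_power_series_at_zero[of "shift C" n p] carr by (simp add: D_def)
  qed
  moreover have "D k t \<in> carrier_mat n p" for k t by (simp add: D_def)
  moreover have "has_mat_derivative n p (D k) (D (Suc k) t) t" if t: "\<bar>t\<bar> < r" for k t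
    unfolding has_mat_derivative_def
  proof (intro conjI allI impI)
    fix i j assume ij: "i < n" "j < p"
    have "((\<lambda>s. \<Sum>m. s ^ m *\<^sub>R (shift ^^ k) C m $$ (i, j)) has_vector_derivative
        (\<Sum>m. t ^ m *\<^sub>R (real (Suc m) *\<^sub>R (shift ^^ k) C (Suc m) $$ (i, j)))) (at t)"
      using inv[of k] ij t by (intro vector_power_series_has_vector_derivative(2)[of r]) auto
    moreover have "(shift ^^ Suc k) C m $$ (i, j) = real (Suc m) *\<^sub>R (shift ^^ k) C (Suc m) $$ (i, j)" for m
      using conjunct1[OF inv, rule_format, of k "Suc m"] ij by (simp add: shift_def)
    ultimately show "((\<lambda>s. D k s $$ (i, j)) has_vector_derivative D (Suc k) t $$ (i, j)) (at t)"
      using ij by (simp add: D_def mat_power_series_def)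
  qed (simp add: D_def)
  ultimately show thesis using that by blast
qed

text \<open>
  The curve \<open>D 0 t = (I - t V)\<^sup>-\<^sup>1 X\<close>, described by the equation \<open>Y = X + t V Y\<close> that it solves, with its
  derivatives \<open>D k\<close>. It is the Neumann series \<open>\<Sum>k. t\<^sup>k V\<^sup>k X\<close>, whose terms are dominated entrywise by
  a geometric series.
\<close>

lemma resolvent_curve:
  fixes V X :: "'a::{real_normed_algebra_1, euclidean_space} mat"
  assumes V: "V \<in> carrier_mat n n" and X: "X \<in> carrier_mat n p"
  obtains r D where "0 < r" "D 0 0 = X" "D 1 0 = V * X"
    "\<And>k t. D k t \<in> carrier_mat n p"
    "\<And>k t. \<bar>t\<bar> < r \<Longrightarrow> has_mat_derivative n p (D k) (D (Suc k) t) t"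
    "\<And>t. \<bar>t\<bar> < r \<Longrightarrow> D 0 t = X + map_mat ((*\<^sub>R) t) (V * D 0 t)"
proof -
  define C where "C k = (((*) V) ^^ k) X" for k
  have C0: "C 0 = X" and CS: "C (Suc k) = V * C k" for k by (simp_all add: C_def)
  have carr: "C k \<in> carrier_mat n p" for k
    by (induction k) (use V X in \<open>auto simp: C0 CS\<close>)
  \<comment> \<open>Any bounds for the absolute values of the entries of \<open>V\<close> and \<open>X\<close> would do; sums also cover empty matrices.\<close>
  define b where "b = (\<Sum>i<n. \<Sum>j<n. norm (V $$ (i, j)))"
  define x where "x = (\<Sum>i<n. \<Sum>j<p. norm (X $$ (i, j)))"
  have le_b: "norm (V $$ (i, j)) \<le> b" if "i < n" "j < n" for i j
  proof -
    have "norm (V $$ (i, j)) \<le> (\<Sum>j<n. norm (V $$ (i, j)))"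
      using that by (intro member_le_sum) auto
    also have "\<dots> \<le> b" unfolding b_def
      using that by (intro member_le_sum[of i _ "\<lambda>i. \<Sum>j<n. norm (V $$ (i, j))"]) (auto intro: sum_nonneg)
    finally show ?thesis .
  qed
  have le_x: "norm (X $$ (i, j)) \<le> x" if "i < n" "j < p" for i j
  proof -
    have "norm (X $$ (i, j)) \<le> (\<Sum>j<p. norm (X $$ (i, j)))"
      using that by (intro member_le_sum) auto
    also have "\<dots> \<le> x" unfolding x_def
      using that by (intro member_le_sum[of i _ "\<lambda>i. \<Sum>j<p. norm (X $$ (i, j))"]) (auto intro: sum_nonneg)
    finally show ?thesis .
  qed
  have b0: "0 \<le> b" by (simp add: b_def sum_nonneg)
  have bound: "norm (C k $$ (i, j)) \<le> (real n * b) ^ k * x" if "i < n" "j < p" for i j k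
    using that
  proof (induction k arbitrary: i)
    case 0
    then show ?case using le_x by (simp add: C0)
  next
    case (Suc k)
    have "norm (C (Suc k) $$ (i, j)) \<le> (\<Sum>l<n. norm (V $$ (i, l) * C k $$ (l, j)))"
      unfolding CS index_mult_mat_sum[OF V carr Suc.prems] by (rule norm_sum)
    also have "\<dots> \<le> (\<Sum>l<n. b * ((real n * b) ^ k * x))"
    proof (rule sum_mono)
      fix l assume "l \<in> {..<n}"
      then have "norm (V $$ (i, l)) * norm (C k $$ (l, j)) \<le> b * ((real n * b) ^ k * x)"
        using Suc b0 le_b by (intro mult_mono) auto
      then show "norm (V $$ (i, l) * C k $$ (l, j)) \<le> b * ((real n * b) ^ k * x)"
        using norm_mult_ineq order_trans by blast
    qed
    finally show ?case by (simp add: mult_ac)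
  qed
  \<comment> \<open>The summand 1 keeps the radius positive when \<open>V\<close> vanishes.\<close>
  define r where "r = inverse (real n * b + 1)"
  have pos: "0 < real n * b + 1" using b0 by (simp add: add_nonneg_pos)
  then have r: "0 < r" by (simp add: r_def)
  have summ: "summable (\<lambda>k. t ^ k *\<^sub>R C k $$ (i, j))" if "\<bar>t\<bar> < r" "i < n" "j < p" for t i j
  proof (rule summable_comparison_test)
    have "\<bar>t\<bar> * (real n * b) \<le> \<bar>t\<bar> * (real n * b + 1)"
      by (simp add: mult_left_mono)
    also have "\<dots> < 1"
      using that(1) pos by (simp add: r_def field_simps)
    finally have "norm (\<bar>t\<bar> * (real n * b)) < 1" using b0 by (simp add: abs_mult)
    then show "summable (\<lambda>k. (\<bar>t\<bar> * (real n * b)) ^ k * x)"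
      by (intro summable_mult2 summable_geometric)
    have "norm (t ^ k *\<^sub>R C k $$ (i, j)) \<le> \<bar>t\<bar> ^ k * ((real n * b) ^ k * x)" for k
      using bound[OF that(2,3)] by (simp add: power_abs mult_left_mono)
    then show "\<exists>N. \<forall>k\<ge>N. norm (t ^ k *\<^sub>R C k $$ (i, j)) \<le> (\<bar>t\<bar> * (real n * b)) ^ k * x"
      by (auto simp: power_mult_distrib mult.assoc)
  qed
  obtain D where D: "D 0 = mat_power_series n p C" "D 1 0 = C 1"
    "\<And>k t. D k t \<in> carrier_mat n p"
    "\<And>k t. \<bar>t\<bar> < r \<Longrightarrow> has_mat_derivative n p (D k) (D (Suc k) t) t"
    using smooth_mat_power_series[OF carr summ] by blast
  have "D 0 t = X + map_mat ((*\<^sub>R) t) (V * D 0 t)" if t: "\<bar>t\<bar> < r" for t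
  proof (rule eq_matI)
    fix i j assume "i < dim_row (X + map_mat ((*\<^sub>R) t) (V * D 0 t))"
      "j < dim_col (X + map_mat ((*\<^sub>R) t) (V * D 0 t))"
    then have ij: "i < n" "j < p" using V D(3)[of 0 t] by auto
    have "(\<lambda>k. t ^ k *\<^sub>R C k $$ (l, j)) sums (D 0 t $$ (l, j))" if "l < n" for l
      using summable_sums[OF summ[OF t that ij(2)]] that ij(2) by (simp add: D(1) mat_power_series_def)
    then have "(\<lambda>k. \<Sum>l<n. V $$ (i, l) * (t ^ k *\<^sub>R C k $$ (l, j))) sums (\<Sum>l<n. V $$ (i, l) * D 0 t $$ (l, j))"
      by (intro sums_sum bounded_linear.sums[OF bounded_linear_mult_right]) auto
    moreover have "(\<Sum>l<n. V $$ (i, l) * (t ^ k *\<^sub>R C k $$ (l, j))) = t ^ k *\<^sub>R C (Suc k) $$ (i, j)" for k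
      unfolding CS index_mult_mat_sum[OF V carr ij] by (simp add: scaleR_sum_right)
    ultimately have "(\<lambda>k. t ^ k *\<^sub>R C (Suc k) $$ (i, j)) sums (V * D 0 t) $$ (i, j)"
      using index_mult_mat_sum[OF V D(3) ij] by simp
    from bounded_linear.sums[OF bounded_linear_scaleR_right[of t] this]
    have "(\<lambda>k. t ^ Suc k *\<^sub>R C (Suc k) $$ (i, j)) sums (t *\<^sub>R (V * D 0 t) $$ (i, j))"
      by simp
    then have "(\<lambda>k. t ^ k *\<^sub>R C k $$ (i, j)) sums (t *\<^sub>R (V * D 0 t) $$ (i, j) + X $$ (i, j))"
      by (subst (asm) sums_Suc_iff) (simp add: C0)
    moreover have "(\<lambda>k. t ^ k *\<^sub>R C k $$ (i, j)) sums (D 0 t $$ (i, j))"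
      using summable_sums[OF summ[OF t ij]] ij by (simp add: D(1) mat_power_series_def)
    ultimately have "D 0 t $$ (i, j) = t *\<^sub>R (V * D 0 t) $$ (i, j) + X $$ (i, j)"
      using sums_unique2 by blast
    moreover have "(X + map_mat ((*\<^sub>R) t) (V * D 0 t)) $$ (i, j) = X $$ (i, j) + t *\<^sub>R (V * D 0 t) $$ (i, j)"
      using X V D(3)[of 0 t] ij by (simp del: index_mult_mat(1))
    ultimately show "D 0 t $$ (i, j) = (X + map_mat ((*\<^sub>R) t) (V * D 0 t)) $$ (i, j)" by simp
  qed (use V X D(3)[of 0 t] in auto)
  moreover have "D 0 0 = X" using mat_power_series_at_zero[OF carr] by (simp only: D(1) C0)
  moreover have "D 1 0 = V * X" using D(2) CS[of 0] by (simp add: C0)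
  ultimately show thesis using that[OF r, of D] D(3,4) by blast
qed

section \<open>Tangent vectors of the Stiefel manifold\<close>

lemma tangent_vector_satisfies_linearised_equation:
  assumes G: "G \<in> carrier_mat n n" and \<xi>: "\<xi> \<in> tangent_space n p (stiefel G p n) X"
  shows "\<xi> \<in> carrier_mat n p" "\<xi>\<^sup>H * G * X + X\<^sup>H * G * \<xi> = 0\<^sub>m p p"
proof -
  obtain \<epsilon> \<gamma> where \<epsilon>: "0 < \<epsilon>" and \<gamma>: "\<forall>t\<in>{-\<epsilon><..<\<epsilon>}. \<gamma> t \<in> stiefel G p n" "\<gamma> 0 = X"
    and der: "has_mat_derivative n p \<gamma> \<xi> 0"
    using \<xi> unfolding tangent_space_def by blast
  define I where "I = {-\<epsilon><..<\<epsilon>}"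
  have I: "open I" "0 \<in> I" using \<epsilon> by (auto simp: I_def)
  have carr: "\<gamma> t \<in> carrier_mat n p" and iso: "(\<gamma> t)\<^sup>H * G * \<gamma> t = 1\<^sub>m p" if "t \<in> I" for t
    using \<gamma>(1) that by (auto simp: I_def stiefel_def)
  have X: "X \<in> carrier_mat n p" using carr[OF I(2)] \<gamma>(2) by simp
  show \<xi>c: "\<xi> \<in> carrier_mat n p" using der by (simp add: has_mat_derivative_def)
  have "has_mat_derivative p n (\<lambda>s. (\<gamma> s)\<^sup>H * G) (\<xi>\<^sup>H * G + (\<gamma> 0)\<^sup>H * 0\<^sub>m n n) 0"
    using has_mat_derivative_herm[OF I carr der] has_mat_derivative_const[OF G] carr G
    by (intro has_mat_derivative_mult[OF I]) auto
  then have "has_mat_derivative p n (\<lambda>s. (\<gamma> s)\<^sup>H * G) (\<xi>\<^sup>H * G) 0"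
    using X \<gamma>(2) \<xi>c G by (simp add: right_mult_zero_mat[of _ p n n] right_add_zero_mat[of _ p n])
  then have "has_mat_derivative p p (\<lambda>s. (\<gamma> s)\<^sup>H * G * \<gamma> s) (\<xi>\<^sup>H * G * \<gamma> 0 + (\<gamma> 0)\<^sup>H * G * \<xi>) 0"
  proof (intro has_mat_derivative_mult[OF I _ _ carr der])
    show "(\<gamma> s)\<^sup>H * G \<in> carrier_mat p n" if "s \<in> I" for s
      using carr[OF that] G by (intro mult_carrier_mat[of _ p n]) auto
  qed
  then have "has_mat_derivative p p (\<lambda>s. 1\<^sub>m p) (\<xi>\<^sup>H * G * \<gamma> 0 + (\<gamma> 0)\<^sup>H * G * \<xi>) 0"
    by (rule has_mat_derivative_transform[OF _ I iso])
  from has_mat_derivative_unique[OF this has_mat_derivative_const]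
  show "\<xi>\<^sup>H * G * X + X\<^sup>H * G * \<xi> = 0\<^sub>m p p" by (simp add: \<gamma>(2))
qed

text \<open>
  Expanding the two Gram matrices, the mixed terms \<open>Y\<^sup>H G Z + Z\<^sup>H G Y\<close>, in which they differ by sign, cancel.
  With \<open>Z = t V Y\<close> for a \<open>G\<close>-skew \<open>V\<close>, this is the statement that the Cayley transform preserves \<open>G\<close>.
\<close>

lemma sum_and_difference_isometric:
  assumes G: "G \<in> carrier_mat n n" and Y: "Y \<in> carrier_mat n p" and Z: "Z \<in> carrier_mat n p"
    and anti: "Z\<^sup>H * G * Y = - (Y\<^sup>H * G * Z)"
  shows "(Y + Z)\<^sup>H * G * (Y + Z) = (Y - Z)\<^sup>H * G * (Y - Z)"
proof -
  have YG: "Y\<^sup>H * G \<in> carrier_mat p n" and ZG: "Z\<^sup>H * G \<in> carrier_mat p n"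
    using G Y Z by auto
  define P Q R where "P = Y\<^sup>H * G * Y" and "Q = Z\<^sup>H * G * Z" and "R = Y\<^sup>H * G * Z"
  have PQR: "P \<in> carrier_mat p p" "Q \<in> carrier_mat p p" "R \<in> carrier_mat p p"
    using YG ZG Y Z by (auto simp: P_def Q_def R_def)
  have "(Y + Z)\<^sup>H * G * (Y + Z) = (Y\<^sup>H * G + Z\<^sup>H * G) * (Y + Z)"
    using G Y Z by (simp add: mat_herm_add[OF Y Z] add_mult_distrib_mat[of _ p n])
  also have "\<dots> = (P + - R) + (R + Q)"
    unfolding mult_add_distrib_mat[OF add_carrier_mat[OF ZG] Y Z]
      add_mult_distrib_mat[OF YG ZG Y] add_mult_distrib_mat[OF YG ZG Z] anti P_def Q_def R_def ..
  finally have plus: "(Y + Z)\<^sup>H * G * (Y + Z) = (P + - R) + (R + Q)" .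
  have "(Y - Z)\<^sup>H * G * (Y - Z) = (Y\<^sup>H * G - Z\<^sup>H * G) * (Y - Z)"
    using G Y Z by (simp add: mat_herm_minus[OF Y Z] minus_mult_distrib_mat[of _ p n])
  also have "\<dots> = (P - - R) - (R - Q)"
    unfolding mult_minus_distrib_mat[OF minus_carrier_mat[OF ZG] Y Z]
      minus_mult_distrib_mat[OF YG ZG Y] minus_mult_distrib_mat[OF YG ZG Z] anti P_def Q_def R_def ..
  finally have minus: "(Y - Z)\<^sup>H * G * (Y - Z) = (P - - R) - (R - Q)" .
  show ?thesis unfolding plus minus using PQR by (intro eq_matI) auto
qed

text \<open>
  The matrices \<open>V\<close> with \<open>V\<^sup>H G = - G V\<close> include all \<open>K G\<close> with \<open>K\<^sup>H = - K\<close>. The choice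
  \<open>\<eta> X\<^sup>H - X \<eta>\<^sup>H\<close> for \<open>K\<close> is skew but maps \<open>X\<close> to \<open>\<eta> - X E\<close> with \<open>E = \<eta>\<^sup>H G X\<close>; the linearised equation
  makes \<open>E\<close> skew, so \<open>X E X\<^sup>H\<close> may be added to correct this.
\<close>

lemma skew_generator:
  assumes G: "G \<in> carrier_mat n n" "G\<^sup>H = G" and X: "X \<in> carrier_mat n p" "X\<^sup>H * G * X = 1\<^sub>m p"
    and \<eta>: "\<eta> \<in> carrier_mat n p" "\<eta>\<^sup>H * G * X + X\<^sup>H * G * \<eta> = 0\<^sub>m p p"
  obtains V where "V \<in> carrier_mat n n" "V * X = \<eta>" "V\<^sup>H * G = - (G * V)"
proof -
  define E where "E = \<eta>\<^sup>H * G * X"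
  have E: "E \<in> carrier_mat p p" using G X \<eta> by (auto simp: E_def)
  have EH: "E\<^sup>H = - E"
  proof -
    have eq: "E\<^sup>H = X\<^sup>H * G * \<eta>" unfolding E_def by (rule sesquilinear_herm[OF G \<eta>(1) X(1)])
    have "E + E\<^sup>H = 0\<^sub>m p p" using \<eta>(2) unfolding eq[symmetric] E_def[symmetric] .
    from arg_cong[OF this, of "\<lambda>M. - E + M"] show ?thesis
      using E by (simp add: assoc_add_mat[of "- E" p p E "E\<^sup>H", symmetric])
  qed
  define K where "K = (\<eta> * X\<^sup>H - X * \<eta>\<^sup>H) + X * E * X\<^sup>H"
  have K1: "\<eta> * X\<^sup>H \<in> carrier_mat n n" and K2: "X * \<eta>\<^sup>H \<in> carrier_mat n n"
    and K3: "X * E * X\<^sup>H \<in> carrier_mat n n" and XE: "X * E \<in> carrier_mat n p"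
    using X \<eta> E by auto
  have K: "K \<in> carrier_mat n n" using K1 K2 K3 by (auto simp: K_def)
  have "(X * E * X\<^sup>H)\<^sup>H = X * (E\<^sup>H * X\<^sup>H)"
    using X by (simp only: mat_herm_mult[OF XE, of "X\<^sup>H" n] mat_herm_carrier mat_herm_mult[OF X(1) E] mat_herm_herm)
  also have "\<dots> = - (X * E * X\<^sup>H)"
    unfolding EH using X E by (simp add: assoc_mult_mat[of _ n p _ p])
  finally have K3H: "(X * E * X\<^sup>H)\<^sup>H = - (X * E * X\<^sup>H)" .
  have "K\<^sup>H = (X * \<eta>\<^sup>H - \<eta> * X\<^sup>H) + - (X * E * X\<^sup>H)"
    unfolding K_def mat_herm_add[OF minus_carrier_mat[OF K2] K3] mat_herm_minus[OF K1 K2] K3H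
    using X \<eta> by (simp add: mat_herm_mult[of _ n p _ n])
  also have "\<dots> = - K"
  proof -
    have "(M - L) + - N = - ((L - M) + N)"
      if "L \<in> carrier_mat n n" "M \<in> carrier_mat n n" "N \<in> carrier_mat n n" for L M N :: "quat mat"
      using that by (intro eq_matI) auto
    from this[OF K1 K2 K3] show ?thesis unfolding K_def .
  qed
  finally have KH: "K\<^sup>H = - K" .
  show thesis
  proof (rule that[of "K * G"])
    show "K * G \<in> carrier_mat n n" using K G by auto
    have GX: "G * X \<in> carrier_mat n p" using G X by auto
    have XGX: "X\<^sup>H * (G * X) = 1\<^sub>m p" and EGX: "\<eta>\<^sup>H * (G * X) = E"
      using X(2) assoc_mult_mat[of "X\<^sup>H" p n G n X p] assoc_mult_mat[of "\<eta>\<^sup>H" p n G n X p] X(1) \<eta>(1) G(1)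
      by (simp_all only: E_def mat_herm_carrier)
    have "K * G * X = K * (G * X)" using K G X by (simp add: assoc_mult_mat[of _ n n])
    also have "\<dots> = \<eta> * X\<^sup>H * (G * X) - X * \<eta>\<^sup>H * (G * X) + X * E * X\<^sup>H * (G * X)"
      unfolding K_def add_mult_distrib_mat[OF minus_carrier_mat[OF K2] K3 GX]
        minus_mult_distrib_mat[OF K1 K2 GX] ..
    also have "\<eta> * X\<^sup>H * (G * X) = \<eta>"
      using X \<eta> GX XGX by (simp add: assoc_mult_mat[of _ n p _ n])
    also have "X * \<eta>\<^sup>H * (G * X) = X * E"
      using X \<eta> GX EGX by (simp add: assoc_mult_mat[of _ n p _ n])
    also have "X * E * X\<^sup>H * (G * X) = X * E"
      using X XE GX XGX by (simp add: assoc_mult_mat[of "X * E" n p _ n] right_mult_one_mat[OF XE])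
    also have "\<eta> - X * E + X * E = \<eta>"
      using \<eta>(1) X(1) E by (intro eq_matI) (auto simp del: index_mult_mat(1))
    finally show "K * G * X = \<eta>" .
    have "(K * G)\<^sup>H * G = (G * - K) * G"
      using K G by (simp add: mat_herm_mult[of _ n n _ n] KH)
    also have "\<dots> = - (G * (K * G))"
      using K G by (simp add: assoc_mult_mat[of _ n n _ n])
    finally show "(K * G)\<^sup>H * G = - (G * (K * G))" .
  qed
qed

text \<open>
  The Cayley curve moves with velocity \<open>2 V X\<close>, so the generator is built for the half \<open>\<eta>\<close> of \<open>\<xi>\<close>.
\<close>

lemma linearised_solution_is_tangent:
  assumes G: "G \<in> carrier_mat n n" "G\<^sup>H = G" and XS: "X \<in> stiefel G p n"
    and \<xi>: "\<xi> \<in> carrier_mat n p" "\<xi>\<^sup>H * G * X + X\<^sup>H * G * \<xi> = 0\<^sub>m p p"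
  shows "\<xi> \<in> tangent_space n p (stiefel G p n) X"
proof -
  have X: "X \<in> carrier_mat n p" "X\<^sup>H * G * X = 1\<^sub>m p" using XS by (auto simp: stiefel_def)
  define \<eta> where "\<eta> = map_mat ((*\<^sub>R) (1/2)) \<xi>"
  have \<eta>: "\<eta> \<in> carrier_mat n p" using \<xi> by (simp add: \<eta>_def)
  have \<eta>2: "\<eta> + \<eta> = \<xi>"
    using \<xi> by (intro eq_matI) (auto simp: \<eta>_def scaleR_left_distrib[symmetric])
  have "\<eta>\<^sup>H * G = map_mat ((*\<^sub>R) (1/2)) (\<xi>\<^sup>H * G)"
    using G \<xi> by (simp add: \<eta>_def mat_herm_scale mult_scale_mat[of _ p n])
  moreover have "\<xi>\<^sup>H * G \<in> carrier_mat p n" "X\<^sup>H * G \<in> carrier_mat p n" using G X \<xi> by auto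
  ultimately have "\<eta>\<^sup>H * G * X + X\<^sup>H * G * \<eta> = map_mat ((*\<^sub>R) (1/2)) (\<xi>\<^sup>H * G * X) + map_mat ((*\<^sub>R) (1/2)) (X\<^sup>H * G * \<xi>)"
    using X \<xi> by (simp add: \<eta>_def mult_scale_mat[of _ p n _ p])
  also have "\<dots> = map_mat ((*\<^sub>R) (1/2)) (\<xi>\<^sup>H * G * X + X\<^sup>H * G * \<xi>)"
    using X(1) G(1) \<xi>(1) by (intro eq_matI) (auto simp: scaleR_add_right simp del: index_mult_mat(1))
  also have "\<dots> = 0\<^sub>m p p"
    unfolding \<xi>(2) by (intro eq_matI) auto
  finally obtain V where V: "V \<in> carrier_mat n n" "V * X = \<eta>" "V\<^sup>H * G = - (G * V)"
    using skew_generator[OF G X \<eta>] by blast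
  obtain r D where r: "0 < r" and D: "D 0 0 = X" "D 1 0 = V * X"
    and Dc: "\<And>k t. D k t \<in> carrier_mat n p"
    and Dd: "\<And>k t. \<bar>t\<bar> < r \<Longrightarrow> has_mat_derivative n p (D k) (D (Suc k) t) t"
    and res: "\<And>t. \<bar>t\<bar> < r \<Longrightarrow> D 0 t = X + map_mat ((*\<^sub>R) t) (V * D 0 t)"
    using resolvent_curve[OF V(1) X(1)] by metis
  \<comment> \<open>This is \<open>(I + t V) (I - t V)\<^sup>-\<^sup>1 X\<close>, written so that its smoothness is evident from that of \<open>D 0\<close>.\<close>
  define \<gamma> where "\<gamma> t = D 0 t + D 0 t - X" for t
  define F where "F k = (case k of 0 \<Rightarrow> \<gamma> | Suc l \<Rightarrow> (\<lambda>t. D k t + D k t))" for k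
  have F: "has_mat_derivative n p (F k) (F (Suc k) t) t" if "\<bar>t\<bar> < r" for k t
  proof (cases k)
    case 0
    have "has_mat_derivative n p (\<lambda>s. D 0 s + D 0 s - X) (D 1 t + D 1 t) t"
      using Dd[OF that, of 0] Dc X
      by (intro has_mat_derivative_minus_const has_mat_derivative_add_self) auto
    then show ?thesis by (simp add: 0 F_def \<gamma>_def[abs_def])
  next
    case (Suc l)
    have "has_mat_derivative n p (\<lambda>s. D k s + D k s) (D (Suc k) t + D (Suc k) t) t"
      using Dd[OF that] Dc by (intro has_mat_derivative_add_self) auto
    then show ?thesis by (simp add: Suc F_def)
  qed
  have \<gamma>c: "\<gamma> t \<in> carrier_mat n p" for t using X Dc by (auto simp: \<gamma>_def)
  have \<gamma>S: "\<gamma> t \<in> stiefel G p n" if t: "\<bar>t\<bar> < r" for t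
  proof -
    define Y Z where "Y = D 0 t" and "Z = map_mat ((*\<^sub>R) t) (V * Y)"
    have Y: "Y \<in> carrier_mat n p" and Z: "Z \<in> carrier_mat n p" and VY: "V * Y \<in> carrier_mat n p"
      using Dc V by (auto simp: Y_def Z_def)
    have YXZ: "Y = X + Z" using res[OF t] by (simp add: Y_def Z_def)
    have XYZ: "X = Y - Z" unfolding YXZ using X Z by (intro eq_matI) auto
    have \<gamma>YZ: "\<gamma> t = Y + Z"
      unfolding \<gamma>_def Y_def[symmetric] XYZ using Y Z by (intro eq_matI) auto
    have "(V * Y)\<^sup>H * G * Y = Y\<^sup>H * (V\<^sup>H * G) * Y"
      using V Y G by (simp add: mat_herm_mult[of _ n n _ p] assoc_mult_mat[of _ p n _ n _ n])
    also have "\<dots> = - (Y\<^sup>H * G * (V * Y))"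
      unfolding V(3) using V Y G by (simp add: assoc_mult_mat[of _ p n _ n _ n] assoc_mult_mat[of _ p n _ n _ p] assoc_mult_mat[of _ n n _ n _ p])
    finally have VY_anti: "(V * Y)\<^sup>H * G * Y = - (Y\<^sup>H * G * (V * Y))" .
    have "Z\<^sup>H * G * Y = map_mat ((*\<^sub>R) t) ((V * Y)\<^sup>H * G * Y)"
      using VY G Y by (simp add: Z_def mat_herm_scale mult_scale_mat[of _ p n _ n] mult_scale_mat[of _ p n _ p])
    also have "\<dots> = - map_mat ((*\<^sub>R) t) (Y\<^sup>H * G * (V * Y))"
      unfolding VY_anti by (intro eq_matI) (auto simp del: index_mult_mat(1))
    also have "map_mat ((*\<^sub>R) t) (Y\<^sup>H * G * (V * Y)) = Y\<^sup>H * G * Z"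
      using VY G Y by (simp add: Z_def mult_scale_mat[of _ p n _ p])
    finally have "(Y + Z)\<^sup>H * G * (Y + Z) = (Y - Z)\<^sup>H * G * (Y - Z)"
      by (rule sum_and_difference_isometric[OF G(1) Y Z])
    then show ?thesis
      using X \<gamma>c[of t] by (simp add: stiefel_def \<gamma>YZ flip: XYZ)
  qed
  have "smooth_mat_curve_on n p {-r<..<r} \<gamma>"
    unfolding smooth_mat_curve_on_def using \<gamma>c F
    by (intro conjI exI[of _ F]) (auto simp: F_def abs_less_iff)
  moreover have "\<gamma> 0 = X"
    unfolding \<gamma>_def D using X by (intro eq_matI) auto
  moreover have "has_mat_derivative n p \<gamma> \<xi> 0"
    using F[of 0 0] r D(2) V(2) \<eta>2 by (simp add: F_def)
  moreover have "\<forall>t\<in>{-r<..<r}. \<gamma> t \<in> stiefel G p n" using \<gamma>S by auto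
  ultimately show ?thesis unfolding tangent_space_def using r by blast
qed

text \<open>
  Multiplying \<open>X B + Z C\<close> from the left by \<open>X\<^sup>H G\<close> and \<open>Z\<^sup>H G\<close> recovers \<open>B\<close> and \<open>C\<close>. This shows both that
  the columns of \<open>X\<close> and \<open>Z\<close> are independent, hence span, and that the linearised equation for
  \<open>X B + Z C\<close> is \<open>B\<^sup>H + B = 0\<close>.
\<close>

lemma linearised_solutions_in_orthonormal_frame:
  assumes G: "G \<in> carrier_mat n n" "G\<^sup>H = G" and "p \<le> n"
    and X: "X \<in> carrier_mat n p" "X\<^sup>H * G * X = 1\<^sub>m p"
    and Z: "Z \<in> carrier_mat n (n - p)" "Z\<^sup>H * G * Z = 1\<^sub>m (n - p)" "X\<^sup>H * G * Z = 0\<^sub>m p (n - p)"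
  shows "{\<xi> \<in> carrier_mat n p. \<xi>\<^sup>H * G * X + X\<^sup>H * G * \<xi> = 0\<^sub>m p p}
    = {X * B + Z * C | B C. B \<in> skew p \<and> C \<in> carrier_mat (n - p) p}"
proof -
  let ?q = "n - p"
  have XG: "X\<^sup>H * G \<in> carrier_mat p n" and ZG: "Z\<^sup>H * G \<in> carrier_mat ?q n" using G X Z by auto
  have ZGX: "Z\<^sup>H * G * X = 0\<^sub>m ?q p"
    using sesquilinear_herm[OF G X(1) Z(1)] unfolding Z(3) by simp
  have coordX: "X\<^sup>H * G * (X * B + Z * C) = B"
    and coordZ: "Z\<^sup>H * G * (X * B + Z * C) = C"
    if B: "B \<in> carrier_mat p m" and C: "C \<in> carrier_mat ?q m" for B C m
  proof -
    have XB: "X * B \<in> carrier_mat n m" and ZC: "Z * C \<in> carrier_mat n m" using X Z B C by auto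
    have "X\<^sup>H * G * (X * B + Z * C) = X\<^sup>H * G * X * B + X\<^sup>H * G * Z * C"
      unfolding mult_add_distrib_mat[OF XG XB ZC] assoc_mult_mat[OF XG X(1) B]
        assoc_mult_mat[OF XG Z(1) C] ..
    then show "X\<^sup>H * G * (X * B + Z * C) = B"
      unfolding X(2) Z(3) using B C by (simp add: left_mult_zero_mat[of _ ?q m])
    have "Z\<^sup>H * G * (X * B + Z * C) = Z\<^sup>H * G * X * B + Z\<^sup>H * G * Z * C"
      unfolding mult_add_distrib_mat[OF ZG XB ZC] assoc_mult_mat[OF ZG X(1) B]
        assoc_mult_mat[OF ZG Z(1) C] ..
    then show "Z\<^sup>H * G * (X * B + Z * C) = C"
      unfolding ZGX Z(2) using B C by (simp add: left_mult_zero_mat[of _ p m])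
  qed
  have constraint: "(X * B + Z * C)\<^sup>H * G * X + X\<^sup>H * G * (X * B + Z * C) = 0\<^sub>m p p \<longleftrightarrow> B\<^sup>H = - B"
    if B: "B \<in> carrier_mat p p" and C: "C \<in> carrier_mat ?q p" for B C
  proof -
    have \<xi>: "X * B + Z * C \<in> carrier_mat n p" using X Z B C by auto
    have "(X * B + Z * C)\<^sup>H * G * X = B\<^sup>H"
      unfolding sesquilinear_herm[OF G X(1) \<xi>, symmetric] coordX[OF B C] ..
    moreover have "B\<^sup>H + B = 0\<^sub>m p p \<longleftrightarrow> B\<^sup>H = - B"
    proof
      assume *: "B\<^sup>H + B = 0\<^sub>m p p"
      show "B\<^sup>H = - B"
      proof (rule eq_matI)
        fix i j assume "i < dim_row (- B)" "j < dim_col (- B)"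
        then have "(B\<^sup>H + B) $$ (i, j) = 0" using B unfolding * by auto
        then show "B\<^sup>H $$ (i, j) = (- B) $$ (i, j)"
          using B \<open>i < dim_row (- B)\<close> \<open>j < dim_col (- B)\<close> by (simp add: eq_neg_iff_add_eq_0)
      qed (use B in auto)
    next
      assume "B\<^sup>H = - B"
      then show "B\<^sup>H + B = 0\<^sub>m p p" using B by simp
    qed
    ultimately show ?thesis by (simp add: coordX[OF B C])
  qed
  have decomp: "\<exists>B\<in>carrier_mat p p. \<exists>C\<in>carrier_mat ?q p. \<xi> = X * B + Z * C"
    if \<xi>: "\<xi> \<in> carrier_mat n p" for \<xi>
  proof (rule columns_span[OF X(1) Z(1) _ \<xi>])
    show "p + ?q = n" using \<open>p \<le> n\<close> by simp
    fix x y :: "quat mat"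
    assume xy: "x \<in> carrier_mat p 1" "y \<in> carrier_mat ?q 1" "X * x + Z * y = 0\<^sub>m n 1"
    have "x = X\<^sup>H * G * 0\<^sub>m n 1" using coordX[OF xy(1,2)] unfolding xy(3) by simp
    moreover have "y = Z\<^sup>H * G * 0\<^sub>m n 1" using coordZ[OF xy(1,2)] unfolding xy(3) by simp
    ultimately show "x = 0\<^sub>m p 1 \<and> y = 0\<^sub>m ?q 1"
      by (simp add: right_mult_zero_mat[OF XG] right_mult_zero_mat[OF ZG])
  qed blast
  show ?thesis
  proof (intro equalityI subsetI)
    fix \<xi> assume \<xi>: "\<xi> \<in> {\<xi> \<in> carrier_mat n p. \<xi>\<^sup>H * G * X + X\<^sup>H * G * \<xi> = 0\<^sub>m p p}"
    with decomp obtain B C where "B \<in> carrier_mat p p" "C \<in> carrier_mat ?q p" "\<xi> = X * B + Z * C"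
      by blast
    with \<xi> constraint show "\<xi> \<in> {X * B + Z * C | B C. B \<in> skew p \<and> C \<in> carrier_mat ?q p}"
      by (auto simp: skew_def)
  next
    fix \<xi> assume "\<xi> \<in> {X * B + Z * C | B C. B \<in> skew p \<and> C \<in> carrier_mat ?q p}"
    then obtain B C where "B \<in> carrier_mat p p" "B\<^sup>H = - B" "C \<in> carrier_mat ?q p" "\<xi> = X * B + Z * C"
      by (auto simp: skew_def)
    moreover from this have "\<xi> \<in> carrier_mat n p" using X Z by auto
    ultimately show "\<xi> \<in> {\<xi> \<in> carrier_mat n p. \<xi>\<^sup>H * G * X + X\<^sup>H * G * \<xi> = 0\<^sub>m p p}"
      using constraint by auto
  qed
qed

theorem proposition2:
  fixes n p :: nat and G X :: "quat mat"
  assumes "0 < p" and "p \<le> n"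
    and "hermitian_pos_def n G"
    and "X \<in> stiefel G p n"
  shows "tangent_space n p (stiefel G p n) X =
           {\<xi> \<in> carrier_mat n p. \<xi>\<^sup>H * G * X + X\<^sup>H * G * \<xi> = 0\<^sub>m p p} \<and>
         (\<forall>Xperp \<in> carrier_mat n (n - p).
            Xperp\<^sup>H * G * Xperp = 1\<^sub>m (n - p) \<and> X\<^sup>H * G * Xperp = 0\<^sub>m p (n - p) \<longrightarrow>
            tangent_space n p (stiefel G p n) X =
              {X * B + Xperp * C | B C. B \<in> skew p \<and> C \<in> carrier_mat (n - p) p})"
proof -
  have G: "G \<in> carrier_mat n n" "G\<^sup>H = G"
    using assms(3) by (auto simp: hermitian_pos_def_def)
  have X: "X \<in> carrier_mat n p" "X\<^sup>H * G * X = 1\<^sub>m p"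
    using assms(4) by (auto simp: stiefel_def)
  have tangent: "tangent_space n p (stiefel G p n) X =
      {\<xi> \<in> carrier_mat n p. \<xi>\<^sup>H * G * X + X\<^sup>H * G * \<xi> = 0\<^sub>m p p}"
    using tangent_vector_satisfies_linearised_equation[OF G(1)]
      linearised_solution_is_tangent[OF G assms(4)] by blast
  show ?thesis
    unfolding tangent
    by (intro conjI refl ballI impI linearised_solutions_in_orthonormal_frame[OF G assms(2) X]) blast+
qed

end
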